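(* For every $n\ge 1$, $P_{\mathrm{DSASM}}=P_{\mathrm{ASM}}\cap P_{\mathrm{DS}}$.
   Context: $[n]=\{1,\dots,n\}$. An $n\times n$ alternating sign matrix (ASM) is an $n\times n$ matrix with entries in $\{0,1,-1\}$ such that in each row and each column the non-zero entries alternate in sign and the first and last non-zero entries are $1$ (so every row and column sums to $1$). $P_{\mathrm{ASM}}\subseteq\mathbb R^{n\times n}$ is the convex hull of all $n\times n$ ASMs. $P_{\mathrm{DS}}=\{X\in\mathbb R^{n\times n}: x_{i,j}=x_{j,i}\ \forall i,j\in[n]\}$. A DSASM (diagonally symmetric ASM) is an $n\times n$ ASM lying in $P_{\mathrm{DS}}$, and $P_{\mathrm{DSASM}}\subseteq\mathbb R^{n\times n}$ is the convex hull of all $n\times n$ DSASMs. *)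

theory Defs
  imports "HOL-Analysis.Analysis"
begin

text \<open>
  The index set \<open>[n]\<close> is rendered by an arbitrary finite linearly ordered type \<open>'n\<close> with
  \<open>n = CARD('n) \<ge> 1\<close>: up to a unique order isomorphism this is \<open>{1..n}\<close> (lemma \<open>index_order_iso\<close>
  below), and every \<open>n \<ge> 1\<close> arises, e.g. from the numeral types of
  \<^theory>\<open>HOL-Library.Numeral_Type\<close>. The order is needed because \<open>first\<close>, \<open>last\<close> and \<open>alternate\<close>
  refer to the positions in a row or column.
\<close>

lemma index_order_iso:
  "\<exists>f :: 'n::{finite,linorder} \<Rightarrow> nat. bij_betw f UNIV {1..CARD('n)} \<and> strict_mono f"
proof -
  define f :: "'n \<Rightarrow> nat" where "f x = card {..x}" for x
  have sm: "strict_mono f"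
    unfolding f_def by (intro strict_monoI psubset_card_mono) auto
  then have inj: "inj f" by (rule strict_mono_imp_inj_on)
  have "f ` UNIV \<subseteq> {1..CARD('n)}"
    unfolding f_def by (auto intro!: card_mono[OF finite subset_UNIV] simp: Suc_le_eq card_gt_0_iff)
  moreover have "card (f ` UNIV) = card {1..CARD('n)}"
    using inj by (simp add: card_image)
  ultimately have "f ` UNIV = {1..CARD('n)}"
    by (intro card_subset_eq) auto
  with inj sm show ?thesis by (auto simp: bij_betw_def)
qed

text \<open>
  A row or column of an ASM. The last two conjuncts say that the first and the last non-zero entry
  exist and equal 1; in particular the zero line is excluded.
\<close>

definition alternating_line :: "('n::linorder \<Rightarrow> real) \<Rightarrow> bool" where
  "alternating_line v \<longleftrightarrow>
     (\<forall>i. v i \<in> {0, 1, -1}) \<and>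
     (\<forall>i j. i < j \<and> v i \<noteq> 0 \<and> v j \<noteq> 0 \<and> (\<forall>k. i < k \<and> k < j \<longrightarrow> v k = 0)
        \<longrightarrow> sgn (v j) = - sgn (v i)) \<and>
     (\<exists>i. v i = 1 \<and> (\<forall>k<i. v k = 0)) \<and>
     (\<exists>i. v i = 1 \<and> (\<forall>k>i. v k = 0))"

definition is_ASM :: "real^('n::{finite,linorder})^('n::{finite,linorder}) \<Rightarrow> bool" where
  "is_ASM A \<longleftrightarrow>
     (\<forall>i. alternating_line (\<lambda>j. A $ i $ j)) \<and> (\<forall>j. alternating_line (\<lambda>i. A $ i $ j))"

definition P_ASM :: "(real^('n::{finite,linorder})^('n::{finite,linorder})) set" where
  "P_ASM = convex hull {A. is_ASM A}"

definition P_DS :: "(real^'n^'n) set" where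
  "P_DS = {X. \<forall>i j. X $ i $ j = X $ j $ i}"

definition is_DSASM :: "real^('n::{finite,linorder})^('n::{finite,linorder}) \<Rightarrow> bool" where
  "is_DSASM A \<longleftrightarrow> is_ASM A \<and> A \<in> P_DS"

definition P_DSASM :: "(real^('n::{finite,linorder})^('n::{finite,linorder})) set" where
  "P_DSASM = convex hull {A. is_DSASM A}"

end

theory Submission
  imports Defs
begin

text \<open>
  Pass from a matrix to its corner sums \<open>H i j\<close>, the sum of the entries weakly above and weakly
  to the left of position \<open>(i, j)\<close>. For a symmetric \<open>X\<close> in the ASM polytope these are symmetric,
  integral on the boundary, and neighbouring corner sums differ by an element of \<open>[0, 1]\<close>.
  All of this survives replacing \<open>H\<close> by \<open>\<lfloor>H + t\<rfloor>\<close>, which is therefore the corner sum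
  matrix of a DSASM for every \<open>t\<close>. As \<open>\<integral>\<^sub>0\<^sup>1 \<lfloor>h + t\<rfloor> dt = h\<close>, averaging over \<open>t\<close> returns \<open>X\<close>.
\<close>

type_synonym 'n square_matrix = "real^'n^'n"

section \<open>Induction, predecessors and telescoping on a finite linear order\<close>

lemma finite_order_less_induct [case_names less]:
  fixes a :: "'n::{finite,order}"
  assumes "\<And>x. (\<And>y. y < x \<Longrightarrow> P y) \<Longrightarrow> P x"
  shows "P a"
proof (induction a rule: measure_induct_rule[of "\<lambda>x. card {..<x}"])
  case (less x)
  have "card {..<y} < card {..<x}" if "y < x" for y
    using that by (intro psubset_card_mono) (auto simp: psubset_eq)
  then show ?case using assms less by blast
qed

text \<open>Stands in for passing from \<open>j\<close> to \<open>j - 1\<close>: the initial segment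
  below \<open>j\<close> is either the empty one or the closed one at the predecessor.\<close>

lemma lessThan_cases:
  fixes j :: "'n::{finite,linorder}"
  obtains "{..<j} = {}" | p where "p < j" "{..<j} = {..p}"
proof (cases "{..<j} = {}")
  case False
  define p where "p = Max {..<j}"
  have "p \<in> {..<j}" unfolding p_def by (rule Max_in) (use False in auto)
  moreover have "k \<le> p" if "k < j" for k
    unfolding p_def by (rule Max_ge) (use that in auto)
  ultimately have "p < j" "{..<j} = {..p}" by auto
  then show thesis by (rule that(2))
qed (rule that(1))

lemma UNIV_eq_atMost_Max: "(UNIV :: 'n::{finite,linorder} set) = {..Max UNIV}"
  by auto

lemma atMost_eq_insert: "{..j :: 'a::linorder} = insert j {..<j}"
  by auto

text \<open>Taking \<open>g\<close> on sets lets \<open>{..<j}\<close> play the preceding index and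
  \<open>{}\<close> the index 0, so no extra index has to be adjoined.\<close>

lemma sum_telescope_atMost:
  fixes g :: "'n::{finite,linorder} set \<Rightarrow> real"
  shows "(\<Sum>l\<le>j. g {..l} - g {..<l}) = g {..j} - g {}"
proof (induction j rule: finite_order_less_induct)
  case (less j)
  have "(\<Sum>l\<le>j. g {..l} - g {..<l})
      = g {..j} - g {..<j} + (\<Sum>l<j. g {..l} - g {..<l})"
    by (simp add: atMost_eq_insert[of j])
  also have "(\<Sum>l<j. g {..l} - g {..<l}) = g {..<j} - g {}"
    by (cases j rule: lessThan_cases) (auto simp: less.IH)
  finally show ?case by simp
qed

section \<open>Alternating lines and partial sums\<close>

text \<open>The non-zero entries run 1, -1, 1, ..., so a sum stopping at one of them is 1 after a 1
  and 0 after a -1; the formula covers both.\<close>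

lemma alternating_line_sum_upto_nonzero:
  fixes v :: "'n::{finite,linorder} \<Rightarrow> real"
  assumes v: "alternating_line v" and nz: "v m \<noteq> 0"
  shows "(\<Sum>k\<le>m. v k) = (1 + v m) / 2"
  using nz
proof (induction m rule: finite_order_less_induct)
  case (less m)
  show ?case
  proof (cases "\<exists>k<m. v k \<noteq> 0")
    case False
    obtain i where i: "v i = 1" "\<forall>k<i. v k = 0"
      using v unfolding alternating_line_def by blast
    with False less.prems have "i = m" by (metis linorder_neqE zero_neq_one)
    moreover have "(\<Sum>k<m. v k) = 0" using False by (intro sum.neutral) auto
    ultimately show ?thesis using i by (simp add: atMost_eq_insert)
  next
    case True
    \<comment> \<open>The preceding non-zero position: only zeros separate it from \<open>m\<close>,
      so the sum before \<open>m\<close> is the one known by induction at \<open>p\<close>.\<close>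
    define p where "p = Max {k. k < m \<and> v k \<noteq> 0}"
    have "p \<in> {k. k < m \<and> v k \<noteq> 0}" unfolding p_def by (rule Max_in) (use True in auto)
    then have p: "p < m" "v p \<noteq> 0" by auto
    have zero: "v k = 0" if "p < k" "k < m" for k
    proof (rule ccontr)
      assume "v k \<noteq> 0"
      then have "k \<le> p" unfolding p_def using that by (intro Max_ge) auto
      with that show False by simp
    qed
    have "sgn (v m) = - sgn (v p)"
      using v p less.prems zero unfolding alternating_line_def by blast
    moreover have "v m \<in> {0,1,-1}" "v p \<in> {0,1,-1}"
      using v unfolding alternating_line_def by auto
    ultimately have "v m = - v p" using p less.prems by auto
    moreover have "(\<Sum>k<m. v k) = (\<Sum>k\<le>p. v k)"
      using p zero by (intro sum.mono_neutral_right) (auto simp: not_le)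
    ultimately show ?thesis using less.IH[OF p] by (simp add: atMost_eq_insert[of m])
  qed
qed

lemma alternating_line_partial_sum:
  fixes v :: "'n::{finite,linorder} \<Rightarrow> real"
  assumes v: "alternating_line v"
  shows "(\<Sum>k\<le>j. v k) \<in> {0, 1}"
proof (cases "\<exists>k\<le>j. v k \<noteq> 0")
  case False
  then have "(\<Sum>k\<le>j. v k) = 0" by (intro sum.neutral) auto
  then show ?thesis by simp
next
  case True
  define p where "p = Max {k. k \<le> j \<and> v k \<noteq> 0}"
  have "p \<in> {k. k \<le> j \<and> v k \<noteq> 0}" unfolding p_def by (rule Max_in) (use True in auto)
  then have p: "p \<le> j" "v p \<noteq> 0" by auto
  have zero: "v k = 0" if "p < k" "k \<le> j" for k
  proof (rule ccontr)
    assume "v k \<noteq> 0"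
    then have "k \<le> p" unfolding p_def using that by (intro Max_ge) auto
    with that show False by simp
  qed
  have "(\<Sum>k\<le>j. v k) = (\<Sum>k\<le>p. v k)"
    using p zero by (intro sum.mono_neutral_right) (auto simp: not_le)
  moreover have "v p \<in> {0,1,-1}" using v unfolding alternating_line_def by auto
  ultimately show ?thesis
    using alternating_line_sum_upto_nonzero[OF v p(2)] p(2) by auto
qed

lemma alternating_line_total_sum:
  fixes v :: "'n::{finite,linorder} \<Rightarrow> real"
  assumes v: "alternating_line v"
  shows "(\<Sum>k\<in>UNIV. v k) = 1"
proof -
  obtain i where i: "v i = 1" "\<forall>k>i. v k = 0"
    using v unfolding alternating_line_def by blast
  have "(\<Sum>k\<in>UNIV. v k) = (\<Sum>k\<le>i. v k)"
    using i by (intro sum.mono_neutral_right) (auto simp: not_le)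
  with alternating_line_sum_upto_nonzero[OF v, of i] i show ?thesis by simp
qed

text \<open>The partial sums trace a path with heights 0 and 1, from the empty sum 0 to 1, and the
  entries are its steps. Up and down steps must alternate, and the first and last proper steps go
  up.\<close>

lemma alternating_lineI:
  fixes v :: "'n::{finite,linorder} \<Rightarrow> real"
  assumes part: "\<And>j. (\<Sum>k\<le>j. v k) \<in> {0, 1}" and total: "(\<Sum>k\<in>UNIV. v k) = 1"
  shows "alternating_line v"
proof -
  have part': "(\<Sum>k<j. v k) \<in> {0, 1}" for j
    by (cases j rule: lessThan_cases) (use part in auto)
  have step: "(\<Sum>k\<le>j. v k) = v j + (\<Sum>k<j. v k)" for j
    by (simp add: atMost_eq_insert)
  have ex: "\<exists>k. v k \<noteq> 0"
    using total by (metis sum.neutral zero_neq_one)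
  have entries: "v i \<in> {0, 1, -1}" for i
    using part[of i] part'[of i] step[of i] by auto
  \<comment> \<open>The step at \<open>i\<close> fixes the height, which stays until
    \<open>j\<close>; a non-zero step at \<open>j\<close> can then only undo the one at
    \<open>i\<close>.\<close>
  have alt: "sgn (v j) = - sgn (v i)"
    if "i < j" "v i \<noteq> 0" "v j \<noteq> 0" "\<forall>k. i < k \<and> k < j \<longrightarrow> v k = 0" for i j
  proof -
    have "(\<Sum>k<j. v k) = (\<Sum>k\<le>i. v k)"
      using that by (intro sum.mono_neutral_right) (auto simp: not_le)
    then show ?thesis
      using part[of i] part'[of i] step[of i] part[of j] step[of j] that by auto
  qed
  have first: "\<exists>i. v i = 1 \<and> (\<forall>k<i. v k = 0)"
  proof -
    define m where "m = Min {k. v k \<noteq> 0}"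
    have "m \<in> {k. v k \<noteq> 0}" unfolding m_def by (rule Min_in) (use ex in auto)
    moreover have zero: "v k = 0" if "k < m" for k
    proof (rule ccontr)
      assume "v k \<noteq> 0"
      then have "m \<le> k" unfolding m_def by (intro Min_le) auto
      with that show False by simp
    qed
    moreover have "(\<Sum>k<m. v k) = 0" using zero by (intro sum.neutral) auto
    ultimately show ?thesis using part[of m] step[of m] by auto
  qed
  have last: "\<exists>i. v i = 1 \<and> (\<forall>k>i. v k = 0)"
  proof -
    define m where "m = Max {k. v k \<noteq> 0}"
    have "m \<in> {k. v k \<noteq> 0}" unfolding m_def by (rule Max_in) (use ex in auto)
    moreover have zero: "v k = 0" if "m < k" for k
    proof (rule ccontr)
      assume "v k \<noteq> 0"
      then have "k \<le> m" unfolding m_def by (intro Max_ge) auto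
      with that show False by simp
    qed
    moreover have "(\<Sum>k\<in>UNIV. v k) = (\<Sum>k\<le>m. v k)"
      using zero by (intro sum.mono_neutral_right) (auto simp: not_le)
    ultimately show ?thesis using part'[of m] step[of m] total by auto
  qed
  show ?thesis
    unfolding alternating_line_def using entries alt first last by blast
qed

section \<open>Linear constraints on the polytopes\<close>

lemma convex_P_DS: "convex (P_DS :: (real^'n^'n) set)"
  unfolding convex_def P_DS_def by simp

text \<open>The constraints hold for each ASM and cut out a convex set, hence pass to the hull. Rows
  are enough, as symmetry will carry them over to columns.\<close>

lemma P_ASM_row_sums:
  fixes X :: "'n::{finite,linorder} square_matrix"
  assumes "X \<in> P_ASM"
  shows "(\<Sum>l\<le>j. X $ i $ l) \<in> {0..1}" and "(\<Sum>l\<in>UNIV. X $ i $ l) = 1"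
proof -
  let ?C = "(\<Inter>i j. {X :: 'n square_matrix. (\<Sum>l\<le>j. X $ i $ l) \<in> {0..1}})
              \<inter> (\<Inter>i. {X. (\<Sum>l\<in>UNIV. X $ i $ l) \<in> {1}})"
  have convex_sum: "convex {X :: 'n square_matrix. (\<Sum>l\<in>B. X $ i $ l) \<in> S}" if "convex S" for B i S
  proof -
    have "linear (\<lambda>X :: 'n square_matrix. \<Sum>l\<in>B. X $ i $ l)"
      by (intro linearI) (simp_all add: sum.distrib sum_distrib_left)
    from convex_linear_vimage[OF this that] show ?thesis by (simp add: vimage_def)
  qed
  have "convex ?C"
    by (intro convex_Int convex_INT convex_sum) simp_all
  moreover have "{A. is_ASM A} \<subseteq> ?C"
  proof
    fix A :: "'n square_matrix" assume "A \<in> {A. is_ASM A}"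
    then have row: "alternating_line (\<lambda>l. A $ k $ l)" for k by (simp add: is_ASM_def)
    have "(\<Sum>l\<le>m. A $ k $ l) \<in> {0..1}" for k m
      using alternating_line_partial_sum[OF row, of k m] by fastforce
    moreover have "(\<Sum>l\<in>UNIV. A $ k $ l) \<in> {1}" for k
      using alternating_line_total_sum[OF row, of k] by simp
    ultimately show "A \<in> ?C" by blast
  qed
  ultimately have "P_ASM \<subseteq> ?C" unfolding P_ASM_def by (rule hull_minimal[rotated])
  with assms have X: "X \<in> ?C" by blast
  from X show "(\<Sum>l\<le>j. X $ i $ l) \<in> {0..1}" by blast
  from X show "(\<Sum>l\<in>UNIV. X $ i $ l) = 1" by blast
qed

section \<open>Rounding corner sums\<close>

definition block_sum :: "real^'n^'m \<Rightarrow> 'm set \<Rightarrow> 'n set \<Rightarrow> real" where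
  "block_sum X A B = (\<Sum>k\<in>A. \<Sum>l\<in>B. X $ k $ l)"

lemma block_sum_empty [simp]: "block_sum X A {} = 0"
  by (simp add: block_sum_def)

lemma block_sum_atMost_left:
  fixes X :: "real^'n^('m::{finite,linorder})"
  shows "block_sum X {..i} B = (\<Sum>l\<in>B. X $ i $ l) + block_sum X {..<i} B"
  by (simp add: block_sum_def atMost_eq_insert)

lemma block_sum_swap:
  assumes "X \<in> P_DS"
  shows "block_sum X A B = block_sum X B A"
proof -
  have "block_sum X A B = (\<Sum>l\<in>B. \<Sum>k\<in>A. X $ k $ l)"
    unfolding block_sum_def by (rule sum.swap)
  then show ?thesis using assms by (simp add: block_sum_def P_DS_def)
qed

text \<open>The mixed second difference that recovers entries from corner sums, taken after applying
  \<open>f\<close> to each of them. An empty block contributes \<open>f 0\<close>, not 0.\<close>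

definition round_corner ::
    "(real \<Rightarrow> real) \<Rightarrow> real^('n::{finite,linorder})^('n::{finite,linorder})
      \<Rightarrow> real^('n::{finite,linorder})^('n::{finite,linorder})" where
  "round_corner f X = (\<chi> i j.
     (f (block_sum X {..i} {..j}) - f (block_sum X {..<i} {..j}))
     - (f (block_sum X {..i} {..<j}) - f (block_sum X {..<i} {..<j})))"

lemma round_corner_id: "round_corner (\<lambda>x. x) X = X"
  unfolding round_corner_def block_sum_atMost_left
  by (simp add: vec_eq_iff atMost_eq_insert)

lemma floor_diff_cases:
  fixes a b :: real
  assumes "a \<le> b" "b \<le> a + 1"
  shows "real_of_int \<lfloor>b\<rfloor> - real_of_int \<lfloor>a\<rfloor> \<in> {0, 1}"
proof -
  have "\<lfloor>a\<rfloor> \<le> \<lfloor>b\<rfloor>" "\<lfloor>b\<rfloor> \<le> \<lfloor>a\<rfloor> + 1" using assms by linarith+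
  then have "\<lfloor>b\<rfloor> = \<lfloor>a\<rfloor> \<or> \<lfloor>b\<rfloor> = \<lfloor>a\<rfloor> + 1" by linarith
  then show ?thesis by auto
qed

lemma round_corner_floor_is_DSASM:
  fixes X :: "real^('n::{finite,linorder})^('n::{finite,linorder})"
  assumes X: "X \<in> P_ASM" and sym: "X \<in> P_DS"
  shows "is_DSASM (round_corner (\<lambda>x. real_of_int \<lfloor>x + t\<rfloor>) X)"
proof -
  define f where "f x = real_of_int \<lfloor>x + t\<rfloor>" for x
  define g where "g i B = f (block_sum X {..i} B) - f (block_sum X {..<i} B)" for i B
  define Y where "Y = round_corner f X"
  have Y: "Y $ i $ j = g i {..j} - g i {..<j}" for i j
    by (simp add: Y_def round_corner_def g_def)
  \<comment> \<open>Telescoping leaves \<open>g i {..j} - g i {}\<close>, and \<open>g i {}\<close>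
    is \<open>f 0 - f 0\<close>.\<close>
  have partial: "(\<Sum>l\<le>j. Y $ i $ l) = g i {..j}" for i j
    unfolding Y by (simp add: sum_telescope_atMost) (simp add: g_def)
  have Y_sym: "Y $ i $ j = Y $ j $ i" for i j
    by (simp add: Y_def round_corner_def block_sum_swap[OF sym, of "{..i}"]
        block_sum_swap[OF sym, of "{..<i}"])
  have row: "alternating_line (\<lambda>j. Y $ i $ j)" for i
  proof (rule alternating_lineI)
    fix j
    show "(\<Sum>l\<le>j. Y $ i $ l) \<in> {0, 1}"
      unfolding partial g_def f_def
      \<comment> \<open>The two rounded arguments differ by a partial row sum of \<open>X\<close>,
        which lies in \<open>[0, 1]\<close>.\<close>
      by (rule floor_diff_cases) (use P_ASM_row_sums(1)[OF X, of i j] in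
          \<open>auto simp: block_sum_atMost_left\<close>)
  next
    \<comment> \<open>Full rows of \<open>X\<close> sum to 1, so these block sums are integers and
      move out of the floor; adding row \<open>i\<close> raises the value by exactly 1.\<close>
    have full: "f (block_sum X A UNIV) = real (card A) + f 0" for A
      by (simp add: block_sum_def P_ASM_row_sums(2)[OF X] f_def add.commute)
    have "(\<Sum>l\<in>UNIV. Y $ i $ l) = g i UNIV"
      using partial[of i "Max UNIV"] by (simp flip: UNIV_eq_atMost_Max)
    also have "\<dots> = 1" by (simp add: g_def full atMost_eq_insert)
    finally show "(\<Sum>l\<in>UNIV. Y $ i $ l) = 1" .
  qed
  moreover have "(\<lambda>i. Y $ i $ j) = (\<lambda>i. Y $ j $ i)" for j
    using Y_sym by blast
  ultimately have "is_DSASM Y"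
    using Y_sym by (simp add: is_DSASM_def is_ASM_def P_DS_def)
  then show ?thesis by (simp add: Y_def f_def[abs_def])
qed

section \<open>Averaging over the shift\<close>

lemma has_integral_floor_shift:
  "((\<lambda>t. real_of_int \<lfloor>x + t\<rfloor>) has_integral x) {0..1}"
proof -
  \<comment> \<open>The shift at which \<open>x + t\<close> reaches the next integer, the only jump
    on \<open>[0, 1]\<close>; for integral \<open>x\<close> it is the right endpoint.\<close>
  define c where "c = 1 - frac x"
  have c: "0 < c" "c \<le> 1" by (simp_all add: c_def frac_lt_1)
  have "((\<lambda>t. real_of_int \<lfloor>x + t\<rfloor>) has_integral of_int \<lfloor>x\<rfloor> * c) {0..c}"
  \<comment> \<open>At \<open>t = c\<close> the floor has already jumped, so that single point is
    discarded.\<close>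
  proof (rule has_integral_spike_finite)
    show "((\<lambda>t. real_of_int \<lfloor>x\<rfloor>) has_integral of_int \<lfloor>x\<rfloor> * c) {0..c}"
      using has_integral_const_real[of "real_of_int \<lfloor>x\<rfloor>" 0 c] c by (simp add: mult.commute)
    show "real_of_int \<lfloor>x + t\<rfloor> = of_int \<lfloor>x\<rfloor>" if "t \<in> {0..c} - {c}" for t
    proof -
      have "\<lfloor>x + t\<rfloor> = \<lfloor>x\<rfloor>"
        using that by (intro floor_unique) (auto simp: c_def frac_def intro: add_increasing2)
      then show ?thesis by simp
    qed
  qed simp
  moreover have "((\<lambda>t. real_of_int \<lfloor>x + t\<rfloor>) has_integral (of_int \<lfloor>x\<rfloor> + 1) * (1 - c)) {c..1}"
  proof (rule has_integral_spike_finite)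
    show "((\<lambda>t. real_of_int \<lfloor>x\<rfloor> + 1) has_integral (of_int \<lfloor>x\<rfloor> + 1) * (1 - c)) {c..1}"
      using has_integral_const_real[of "real_of_int \<lfloor>x\<rfloor> + 1" c 1] c by (simp add: mult.commute)
    show "real_of_int \<lfloor>x + t\<rfloor> = of_int \<lfloor>x\<rfloor> + 1" if "t \<in> {c..1} - {}" for t
    proof -
      have "c \<le> t" "t \<le> 1" using that by auto
      then have "\<lfloor>x + t\<rfloor> = \<lfloor>x\<rfloor> + 1"
        unfolding c_def frac_def by linarith
      then show ?thesis by simp
    qed
  qed simp
  ultimately have "((\<lambda>t. real_of_int \<lfloor>x + t\<rfloor>) has_integral
      of_int \<lfloor>x\<rfloor> * c + (of_int \<lfloor>x\<rfloor> + 1) * (1 - c)) {0..1}"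
    by (rule has_integral_combine[rotated 2]) (use c in auto)
  moreover have "of_int \<lfloor>x\<rfloor> * c + (of_int \<lfloor>x\<rfloor> + 1) * (1 - c) = x"
    by (simp add: c_def frac_def algebra_simps)
  ultimately show ?thesis by simp
qed

text \<open>Each entry is a signed sum of four floors, so integration acts on them separately and
  replaces each floor by its argument.\<close>

lemma has_integral_inner_round_corner_floor:
  "((\<lambda>t. a \<bullet> round_corner (\<lambda>x. real_of_int \<lfloor>x + t\<rfloor>) X) has_integral a \<bullet> X) {0..1}"
proof -
  have "((\<lambda>t. a \<bullet> round_corner (\<lambda>x. real_of_int \<lfloor>x + t\<rfloor>) X)
      has_integral a \<bullet> round_corner (\<lambda>x. x) X) {0..1}"
    unfolding inner_vec_def round_corner_def
    by (auto intro!: has_integral_sum has_integral_mult_right has_integral_diff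
        has_integral_floor_shift)
  then show ?thesis by (simp add: round_corner_id)
qed

text \<open>Finiteness makes the hull compact, hence closed, as the separation argument
  requires.\<close>

lemma finite_is_DSASM:
  "finite {A :: real^('n::{finite,linorder})^('n::{finite,linorder}). is_DSASM A}"
proof (rule finite_subset)
  let ?F = "PiE (UNIV :: ('n \<times> 'n) set) (\<lambda>_. {0, 1, -1 :: real})"
  show "finite ((\<lambda>f. \<chi> i j. f (i, j)) ` ?F)"
    by (intro finite_imageI finite_PiE) auto
  show "{A :: 'n square_matrix. is_DSASM A} \<subseteq> (\<lambda>f. \<chi> i j. f (i, j)) ` ?F"
  proof
    fix A :: "'n square_matrix" assume "A \<in> {A. is_DSASM A}"
    then have "A $ i $ j \<in> {0, 1, -1}" for i j
      by (auto simp: is_DSASM_def is_ASM_def alternating_line_def)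
    then have "(\<lambda>(i, j). A $ i $ j) \<in> ?F" by auto
    then show "A \<in> (\<lambda>f. \<chi> i j. f (i, j)) ` ?F"
      by (rule rev_image_eqI) (simp add: vec_eq_iff)
  qed
qed

theorem theorem7p3:
  "(P_DSASM :: (real^('n::{finite,linorder})^('n::{finite,linorder})) set) = P_ASM \<inter> P_DS"
proof
  have "P_DSASM \<subseteq> (P_ASM :: 'n square_matrix set)"
    unfolding P_DSASM_def P_ASM_def by (rule hull_mono) (auto simp: is_DSASM_def)
  moreover have "P_DSASM \<subseteq> (P_DS :: 'n square_matrix set)"
    unfolding P_DSASM_def by (rule hull_minimal) (auto simp: is_DSASM_def convex_P_DS)
  ultimately show "P_DSASM \<subseteq> (P_ASM \<inter> P_DS :: 'n square_matrix set)" by blast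
next
  show "(P_ASM \<inter> P_DS :: 'n square_matrix set) \<subseteq> P_DSASM"
  proof (rule subsetI, rule ccontr)
    fix X :: "'n square_matrix"
    assume X: "X \<in> P_ASM \<inter> P_DS" and nmem: "X \<notin> P_DSASM"
    have "convex (P_DSASM :: 'n square_matrix set)" "closed (P_DSASM :: 'n square_matrix set)"
      unfolding P_DSASM_def
      by (simp_all add: finite_is_DSASM finite_imp_compact_convex_hull compact_imp_closed)
    \<comment> \<open>A separating functional reduces the average over \<open>t\<close> to a scalar
      integral: every rounding lies above \<open>b\<close>, hence so does their average
      \<open>X\<close>, up to equality. No explicit finite convex combination is needed.\<close>
    from separating_hyperplane_closed_point[OF this nmem]
    obtain a b where ab: "a \<bullet> X < b" "\<forall>Y\<in>P_DSASM. a \<bullet> Y > b"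
      by blast
    have "b \<le> a \<bullet> round_corner (\<lambda>x. real_of_int \<lfloor>x + t\<rfloor>) X" for t
    proof -
      have "round_corner (\<lambda>x. real_of_int \<lfloor>x + t\<rfloor>) X \<in> P_DSASM"
        unfolding P_DSASM_def
        by (rule hull_inc) (use X in \<open>simp add: round_corner_floor_is_DSASM\<close>)
      with ab(2) show ?thesis by (simp add: less_imp_le)
    qed
    moreover have "((\<lambda>t. b) has_integral b) {0..1::real}"
      using has_integral_const_real[of b 0 1] by simp
    ultimately have "b \<le> a \<bullet> X"
      by (rule has_integral_le[OF _ has_integral_inner_round_corner_floor, rotated])
    with ab(1) show False by simp
  qed
qed

end
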